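(* There exists a (non-empty) topological dynamical system $(X,T)$ which is infinite-to-one, has no small preimages, and supports a globally supported ergodic invariant measure (an ergodic $T$-invariant Borel probability measure whose topological support is all of $X$), but whose topological entropy is $h(X,T)=\log 2$.
   Context: A topological dynamical system $(X,T)$ is a continuous onto map $T:X\to X$ of a compact metric space $X$. It is infinite-to-one if $T^{-1}(x)$ is infinite for every $x\in X$. It has no small preimages if there is $\delta>0$ such that for every $x\in X$ the preimage set $T^{-1}(x)$ has diameter $>\delta$. *)

theory Defs
  imports "HOL-Probability.Probability"
begin

(* The space is a compact subset X of a metric type; values of T outside X are irrelevant.
   Every compact metric space is homeomorphic to a compact subset of the type nat => real,
   and by uniform continuity all notions below, including no_small_preimages, are invariant
   under homeomorphisms of compact spaces. *)
definition tds :: "'a::metric_space set \<Rightarrow> ('a \<Rightarrow> 'a) \<Rightarrow> bool" where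
  "tds X T \<longleftrightarrow> compact X \<and> continuous_on X T \<and> T ` X = X"

definition infinite_to_one :: "'a set \<Rightarrow> ('a \<Rightarrow> 'a) \<Rightarrow> bool" where
  "infinite_to_one X T \<longleftrightarrow> (\<forall>x\<in>X. infinite (T -` {x} \<inter> X))"

definition no_small_preimages :: "'a::metric_space set \<Rightarrow> ('a \<Rightarrow> 'a) \<Rightarrow> bool" where
  "no_small_preimages X T \<longleftrightarrow> (\<exists>\<delta>>0. \<forall>x\<in>X. diameter (T -` {x} \<inter> X) > \<delta>)"

definition borel_probability_on :: "'a::topological_space set \<Rightarrow> 'a measure \<Rightarrow> bool" where
  "borel_probability_on X M \<longleftrightarrow> prob_space M \<and> sets M = sets (restrict_space borel X)"

definition invariant_measure :: "('a \<Rightarrow> 'a) \<Rightarrow> 'a measure \<Rightarrow> bool" where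
  "invariant_measure T M \<longleftrightarrow>
     T \<in> measurable M M \<and> (\<forall>A\<in>sets M. emeasure M (T -` A \<inter> space M) = emeasure M A)"

definition ergodic_measure :: "('a \<Rightarrow> 'a) \<Rightarrow> 'a measure \<Rightarrow> bool" where
  "ergodic_measure T M \<longleftrightarrow> invariant_measure T M \<and>
     (\<forall>A\<in>sets M. T -` A \<inter> space M = A \<longrightarrow> measure M A = 0 \<or> measure M A = 1)"

definition measure_support :: "'a::topological_space measure \<Rightarrow> 'a set" where
  "measure_support M =
     {x \<in> space M. \<forall>U. open U \<and> x \<in> U \<longrightarrow> emeasure M (U \<inter> space M) > 0}"

(* (n, eps)-separation: the Bowen metric max_{i<n} dist (T^i x) (T^i y) exceeds eps *)
definition separated_set ::
  "'a::metric_space set \<Rightarrow> ('a \<Rightarrow> 'a) \<Rightarrow> nat \<Rightarrow> real \<Rightarrow> 'a set \<Rightarrow> bool" where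
  "separated_set X T n \<epsilon> E \<longleftrightarrow> E \<subseteq> X \<and> finite E \<and>
     (\<forall>x\<in>E. \<forall>y\<in>E. x \<noteq> y \<longrightarrow> (\<exists>i<n. dist ((T ^^ i) x) ((T ^^ i) y) > \<epsilon>))"

(* For compact X, continuous T and eps > 0 the cardinalities are bounded, so this
   supremum of natural numbers is a maximum. *)
definition sep_num :: "'a::metric_space set \<Rightarrow> ('a \<Rightarrow> 'a) \<Rightarrow> nat \<Rightarrow> real \<Rightarrow> nat" where
  "sep_num X T n \<epsilon> = Sup {card E | E. separated_set X T n \<epsilon> E}"

(* Bowen-Dinaburg entropy with natural logarithms. The growth rate is antitone in eps,
   so the limit eps -> 0 is the supremum over eps > 0. *)
definition top_entropy :: "'a::metric_space set \<Rightarrow> ('a \<Rightarrow> 'a) \<Rightarrow> ereal" where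
  "top_entropy X T =
     (SUP \<epsilon>\<in>{0<..}. limsup (\<lambda>n. ereal (ln (real (sep_num X T n \<epsilon>)) / real n)))"

end

theory Submission
  imports Defs "HOL-Real_Asymp.Real_Asymp"
begin

text \<open>
  The example is a one-sided shift on real sequences. The symbols are a marker, the star, and the
  letters $0, 1, 1/2, 1/3, \ldots$. Stars may stand anywhere. Every gap between two stars is filled by
  a block that depends only on the length of the gap, and a gap that never ends is filled with
  zeros. Only the word in front of the first star is free: it may be any finite or infinite word in
  which the letters strictly between $0$ and $1$ increase from left to right.

  Preimages. In front of a point one may put $0$, or $1$, or any letter $1/m$ that is smaller than
  the nonzero letters of the initial word. So fibres are infinite (\<open>infinite_preimage\<close>), and they
  contain two points whose coordinates $0$ differ by $1$ (\<open>preimage_dist\<close>).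

  Entropy. The sequences of zeros and ones are contained in the space, so the entropy is at least
  $\log 2$. Conversely, up to a small error the first $N$ coordinates of a point are
  known from the following data: the position of the first star, one bit per coordinate (zero or one in
  front of the first star, star or not behind it), the positions of the finitely many larger letters
  $1/m$, each of which occurs at most once in front of the first star, and the end of the last gap. These are
  $2^N$ times polynomially many possibilities (\<open>profile_close\<close>, \<open>card_profiles\<close>). Determining the
  blocks by the lengths of their gaps is essential here: the free choices in front of the
  first star and the choices of stars behind it compete for the same coordinates.

  Measure. Let fair coins decide where the stars are, and fill the gaps. Seen from position $0$ this
  is a coin sequence together with the time since the last star, which is geometric and independent of
  the coins. The resulting measure is invariant. It is ergodic because the first
  star erases the memory of that time, so that invariant sets become invariant events of the coin
  sequence. It has full support because the blocks enumerate all admissible words, so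
  each word that can stand in front of the first star is also the end of a block (\<open>block_suffix\<close>).
  The blocks begin with zeros over half their length; this makes the space closed, since gaps whose
  lengths tend to infinity converge to a gap filled with zeros.
\<close>

section \<open>Sequences with prescribed gaps\<close>

text \<open>
  The letter $1/0$ is $0$, so the letters form a sequence together with its limit. The marker $2$ is at
  distance at least $1$ from all of them.
\<close>

abbreviation (input) star :: real where "star \<equiv> 2"

definition letters :: "real set" where
  "letters = range (\<lambda>m::nat. 1 / real m)"

text \<open>
  The entries $0$ and $1$ are unrestricted; they produce the entropy $\log 2$. The letters strictly
  between $0$ and $1$ must increase from left to right. Hence infinitely many letters can still be
  put in front of a finite word, while each letter $1/m$ with $m \ge 2$ occurs at most once in it.
\<close>

definition word_ok :: "(nat \<Rightarrow> real) \<Rightarrow> nat \<Rightarrow> bool" where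
  "word_ok z N \<longleftrightarrow> (\<forall>j<N. z j \<in> letters) \<and>
     (\<forall>i j. i < j \<longrightarrow> j < N \<longrightarrow> 0 < z i \<longrightarrow> z i < 1 \<longrightarrow> 0 < z j \<longrightarrow> z j < 1 \<longrightarrow> z i < z j)"

text \<open>
  The content of a completed gap of length $L$. The number $L$ codes a pair of a padding number and
  a list $u$; the block is $u$ preceded by zeros. The padding number makes every word $u$ occur at
  arbitrarily large $L$, and the condition $2 |u| \le L$ keeps the first half of the block zero.
\<close>

definition block :: "nat \<Rightarrow> nat \<Rightarrow> real" where
  "block L k = (let u = snd (from_nat L :: nat \<times> nat list); s = L - length u in
     if word_ok (\<lambda>j. 1 / real (u ! j)) (length u) \<and> 2 * length u \<le> L \<and> s \<le> k \<and> k < L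
     then 1 / real (u ! (k - s)) else 0)"

text \<open>
  The condition on an incomplete gap uses a finite window: if at least $2k + 1$ positions after a
  star contain no further star, then the gap is so long that its entry number $k$ lies in the zero
  half of its block, wherever it ends. So every condition involves finitely many
  coordinates, which makes the space closed, and a gap that never ends is filled with zeros.
  Only the entries in front of the first star are not determined by the positions of the stars.
\<close>

definition block_space :: "(nat \<Rightarrow> real) set" where
  "block_space = {z. (\<forall>j. z j = star \<or> z j \<in> letters) \<and>
     (\<forall>i L. z i = star \<longrightarrow> z (i + 1 + L) = star \<longrightarrow> (\<forall>k<L. z (i + 1 + k) \<noteq> star) \<longrightarrow>
        (\<forall>k<L. z (i + 1 + k) = block L k)) \<and>
     (\<forall>i k. z i = star \<longrightarrow> (\<forall>l\<le>2 * k. z (i + 1 + l) \<noteq> star) \<longrightarrow> z (i + 1 + k) = 0) \<and>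
     (\<forall>i j. i < j \<longrightarrow> (\<forall>l. i \<le> l \<longrightarrow> l \<le> j \<longrightarrow> z l \<noteq> star) \<longrightarrow>
        0 < z i \<longrightarrow> z i < 1 \<longrightarrow> 0 < z j \<longrightarrow> z j < 1 \<longrightarrow> z i < z j)}"

definition seq_shift :: "(nat \<Rightarrow> 'a) \<Rightarrow> nat \<Rightarrow> 'a" where
  "seq_shift z = (\<lambda>j. z (Suc j))"

lemma funpow_shift: "(seq_shift ^^ i) z j = z (i + j)"
  by (induction i arbitrary: z j) (auto simp: seq_shift_def)

lemma lettersD:
  assumes "a \<in> letters" shows "0 \<le> a" "a \<le> 1" "a \<noteq> star"
proof -
  obtain m where m: "a = 1 / real m" using assms by (auto simp: letters_def)
  show "0 \<le> a" "a \<le> 1" by (auto simp: m divide_simps)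
  then show "a \<noteq> star" by auto
qed

lemma letters_0_1 [simp]: "0 \<in> letters" "1 \<in> letters"
  unfolding letters_def by (auto intro: range_eqI[of _ _ 0] range_eqI[of _ _ 1])

lemma letter_inverse [simp]: "1 / real m \<in> letters"
  by (auto simp: letters_def)

lemma block_spaceD:
  assumes "z \<in> block_space"
  shows "\<And>j. z j \<noteq> star \<Longrightarrow> z j \<in> letters"
    and "\<And>i L k. z i = star \<Longrightarrow> z (i + 1 + L) = star \<Longrightarrow> (\<And>k. k < L \<Longrightarrow> z (i + 1 + k) \<noteq> star) \<Longrightarrow>
           k < L \<Longrightarrow> z (i + 1 + k) = block L k"
    and "\<And>i k. z i = star \<Longrightarrow> (\<And>l. l \<le> 2 * k \<Longrightarrow> z (i + 1 + l) \<noteq> star) \<Longrightarrow> z (i + 1 + k) = 0"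
    and "\<And>i j. i < j \<Longrightarrow> (\<And>l. i \<le> l \<Longrightarrow> l \<le> j \<Longrightarrow> z l \<noteq> star) \<Longrightarrow>
           0 < z i \<Longrightarrow> z i < 1 \<Longrightarrow> 0 < z j \<Longrightarrow> z j < 1 \<Longrightarrow> z i < z j"
  using assms unfolding block_space_def by blast+

lemma block_letters: "block L k \<in> letters"
  by (auto simp: block_def Let_def)

lemma block_initial: assumes "2 * k < L" shows "block L k = 0"
  using assms by (auto simp: block_def Let_def)

lemma block_increasing:
  assumes "i < j" "j < L" "0 < block L i" "block L i < 1" "0 < block L j" "block L j < 1"
  shows "block L i < block L j"
proof -
  define u where "u = snd (from_nat L :: nat \<times> nat list)"
  define s where "s = L - length u"
  have b: "block L k = (if word_ok (\<lambda>j. 1 / real (u ! j)) (length u) \<and> 2 * length u \<le> L \<and> s \<le> k \<and> k < L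
     then 1 / real (u ! (k - s)) else 0)" for k
    by (simp add: block_def u_def s_def Let_def)
  have ok: "word_ok (\<lambda>j. 1 / real (u ! j)) (length u)" "2 * length u \<le> L" "s \<le> i"
    using assms(3) by (auto simp: b split: if_splits)
  have "i - s < j - s" "j - s < length u"
    using ok assms(1,2) by (auto simp: s_def)
  then show ?thesis
    using ok assms unfolding b word_ok_def by auto
qed

text \<open>
  An arbitrary word can be met in front of the first star, but in the support of the measure it has to
  be the end of a completed gap. This is why the blocks enumerate all words.
\<close>

lemma block_suffix:
  assumes "word_ok z N"
  shows "\<exists>i. \<forall>j<N. block (i + N) (i + j) = z j"
proof -
  have "\<forall>j. \<exists>m. j < N \<longrightarrow> z j = 1 / real m"
    using assms by (auto simp: word_ok_def letters_def)
  then obtain m where m: "\<And>j. j < N \<Longrightarrow> z j = 1 / real (m j)"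
    by metis
  define u where "u = map m [0..<N]"
  have len: "length u = N" and nth: "\<And>j. j < N \<Longrightarrow> 1 / real (u ! j) = z j"
    using m by (auto simp: u_def)
  have "inj (\<lambda>p::nat. to_nat (p, u))"
    by (rule injI) simp
  then have "infinite (range (\<lambda>p::nat. to_nat (p, u)))"
    using range_inj_infinite by blast
  then obtain p :: nat where p: "2 * N \<le> to_nat (p, u)"
    unfolding infinite_nat_iff_unbounded_le by blast
  define L where "L = to_nat (p, u)"
  have u: "snd (from_nat L :: nat \<times> nat list) = u"
    by (simp add: L_def)
  have ok: "word_ok (\<lambda>j. 1 / real (u ! j)) (length u)"
    using assms nth unfolding word_ok_def len by auto
  have "block ((L - N) + N) ((L - N) + j) = z j" if "j < N" for j
    using p that ok nth[OF that] len by (auto simp: block_def Let_def u L_def[symmetric])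
  then show ?thesis by blast
qed

lemma block_space_shift: assumes "z \<in> block_space" shows "seq_shift z \<in> block_space"
proof -
  note D = block_spaceD[OF assms]
  have 1: "seq_shift z j = star \<or> seq_shift z j \<in> letters" for j
    using D(1) by (auto simp: seq_shift_def)
  have 2: "seq_shift z (i + 1 + k) = block L k" if "seq_shift z i = star" "seq_shift z (i + 1 + L) = star"
    "\<forall>k<L. seq_shift z (i + 1 + k) \<noteq> star" "k < L" for i L k
    using D(2)[of "Suc i" L k] that by (auto simp: seq_shift_def)
  have 3: "seq_shift z (i + 1 + k) = 0" if "seq_shift z i = star" "\<forall>l\<le>2*k. seq_shift z (i + 1 + l) \<noteq> star" for i k
    using D(3)[of "Suc i" k] that by (auto simp: seq_shift_def)
  have 4: "seq_shift z i < seq_shift z j" if "i < j" "\<forall>l. i \<le> l \<longrightarrow> l \<le> j \<longrightarrow> seq_shift z l \<noteq> star"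
     "0 < seq_shift z i" "seq_shift z i < 1" "0 < seq_shift z j" "seq_shift z j < 1" for i j
  proof -
    have "z l \<noteq> star" if "Suc i \<le> l" "l \<le> Suc j" for l
      using \<open>\<forall>l. i \<le> l \<longrightarrow> l \<le> j \<longrightarrow> seq_shift z l \<noteq> star\<close>[rule_format, of "l - 1"] that
      by (cases l) (auto simp: seq_shift_def)
    then show ?thesis
      using D(4)[of "Suc i" "Suc j"] that by (auto simp: seq_shift_def)
  qed
  show ?thesis
    unfolding block_space_def using 1 2 3 4 by blast
qed

text \<open>
  A nonstar symbol in front of a point never closes a gap behind a star, so only the monotonicity of
  the first word has to be respected.
\<close>

lemma block_space_prepend:
  assumes z: "z \<in> block_space" and a: "a \<in> letters"
    and small: "\<And>j. 0 < a \<Longrightarrow> a < 1 \<Longrightarrow> (\<And>l. l \<le> j \<Longrightarrow> z l \<noteq> star) \<Longrightarrow> 0 < z j \<Longrightarrow> z j < 1 \<Longrightarrow> a < z j"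
  shows "case_nat a z \<in> block_space"
proof -
  note D = block_spaceD[OF z]
  let ?z = "case_nat a z"
  have na: "a \<noteq> star" using lettersD(3)[OF a] .
  have 1: "?z j = star \<or> ?z j \<in> letters" for j
    using D(1) a by (cases j) auto
  have 2: "?z (i + 1 + k) = block L k" if "?z i = star" "?z (i + 1 + L) = star"
    "\<forall>k<L. ?z (i + 1 + k) \<noteq> star" "k < L" for i L k
    using D(2)[of "i - 1" L k] that na by (cases i) auto
  have 3: "?z (i + 1 + k) = 0" if "?z i = star" "\<forall>l\<le>2*k. ?z (i + 1 + l) \<noteq> star" for i k
    using D(3)[of "i - 1" k] that na by (cases i) auto
  have 4: "?z i < ?z j" if ij: "i < j" and "\<forall>l. i \<le> l \<longrightarrow> l \<le> j \<longrightarrow> ?z l \<noteq> star"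
     "0 < ?z i" "?z i < 1" "0 < ?z j" "?z j < 1" for i j
  proof -
    obtain j' where j: "j = Suc j'" using ij by (cases j) auto
    have ns: "z l \<noteq> star" if "i \<le> Suc l" "l \<le> j'" for l
      using \<open>\<forall>l. i \<le> l \<longrightarrow> l \<le> j \<longrightarrow> ?z l \<noteq> star\<close>[rule_format, of "Suc l"] that j by auto
    show ?thesis
    proof (cases i)
      case 0
      then show ?thesis using small[of j'] ns that j by auto
    next
      case (Suc i')
      then show ?thesis using D(4)[of i' j'] ns that j by auto
    qed
  qed
  show ?thesis
    unfolding block_space_def using 1 2 3 4 by blast
qed

lemma shift_case_nat [simp]: "seq_shift (case_nat a z) = z"
  by (simp add: seq_shift_def)

lemma shift_onto: "seq_shift ` block_space = block_space"
proof
  show "block_space \<subseteq> seq_shift ` block_space"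
    using block_space_prepend[where a = 0] by (metis image_eqI letters_0_1(1) less_irrefl shift_case_nat subsetI)
qed (use block_space_shift in auto)

lemma continuous_shift: "continuous_on S (seq_shift :: (nat \<Rightarrow> real) \<Rightarrow> _)"
  unfolding seq_shift_def
  by (intro continuous_on_coordinatewise_then_product continuous_on_subset[OF continuous_on_product_coordinates]) auto

lemma compact_letters: "compact (insert star letters)"
proof -
  have "(\<lambda>m. 1 / real m) \<longlonglongrightarrow> 0" by real_asymp
  then have "compact (insert 0 letters)"
    unfolding letters_def by (rule compact_sequence_with_limit)
  then show ?thesis
    by (simp add: insert_absorb)
qed

section \<open>Compactness\<close>

text \<open>
  All symbols except $0$ are isolated, so conditions on finitely many nonzero entries pass to limits.
\<close>

lemma isolated_letter:
  assumes "a = star \<or> a \<in> letters" "a \<noteq> 0"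
  shows "\<exists>e>0. \<forall>b. (b = star \<or> b \<in> letters) \<longrightarrow> \<bar>b - a\<bar> < e \<longrightarrow> b = a"
proof -
  have pos: "a > 0" using assms by (auto dest: lettersD simp: less_le)
  define S where "S = insert star ((\<lambda>m. 1 / real m) ` {..nat \<lceil>2 / a\<rceil>})"
  have "finite S" by (simp add: S_def)
  then obtain d where d: "d > 0" "\<And>b. b \<in> S \<Longrightarrow> b \<noteq> a \<Longrightarrow> d \<le> dist a b"
    using finite_set_avoid by metis
  have "b \<in> S" if b: "b = star \<or> b \<in> letters" and "\<bar>b - a\<bar> < a / 2" for b
  proof (cases "b = star")
    case False
    then obtain m where m: "b = 1 / real m" using b by (auto simp: letters_def)
    have "a / 2 < 1 / real m" using that m by (auto simp: abs_if split: if_splits)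
    then have "real m < 2 / a" using pos by (cases "m = 0") (auto simp: field_simps)
    then have "m \<le> nat \<lceil>2 / a\<rceil>" by linarith
    then show ?thesis by (auto simp: S_def m)
  qed (simp add: S_def)
  then show ?thesis
    using d pos by (intro exI[of _ "min d (a / 2)"]) (force simp: dist_real_def abs_minus_commute)
qed


lemma block_space_limit:
  assumes x: "\<And>n. x n \<in> block_space" and lim: "\<And>j. (\<lambda>n. x n j) \<longlonglongrightarrow> z j"
  shows "z \<in> block_space"
proof -
  have x_alpha: "x n j = star \<or> x n j \<in> letters" for n j
    using block_spaceD(1)[OF x] by blast
  have 1: "z j = star \<or> z j \<in> letters" for j
    using closed_sequentially[OF compact_imp_closed[OF compact_letters], of "\<lambda>n. x n j" "z j"]
      x_alpha lim by auto
  have ev: "eventually (\<lambda>n. x n j = z j) sequentially" if nz: "z j \<noteq> 0" for j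
  proof -
    obtain e where "e > 0" "\<And>b. b = star \<or> b \<in> letters \<Longrightarrow> \<bar>b - z j\<bar> < e \<Longrightarrow> b = z j"
      using isolated_letter[OF 1[of j] nz] by blast
    then show ?thesis
      using tendstoD[OF lim[of j] \<open>e > 0\<close>] x_alpha
      by (auto elim!: eventually_mono simp: dist_real_def)
  qed
  have ev_star: "eventually (\<lambda>n. x n j = star \<longleftrightarrow> z j = star) sequentially" for j
  proof (cases "z j = star")
    case True
    then show ?thesis using ev[of j] by (auto elim!: eventually_mono)
  next
    case False
    then have "z j < star" using 1[of j] lettersD(2)[of "z j"] by auto
    then show ?thesis using order_tendstoD(2)[OF lim[of j], of star] by (auto elim!: eventually_mono)
  qed
  have ev_stars: "eventually (\<lambda>n. \<forall>j\<le>N. x n j = star \<longleftrightarrow> z j = star) sequentially" for N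
    using eventually_ball_finite[of "{..N}" "\<lambda>n j. x n j = star \<longleftrightarrow> z j = star" sequentially] ev_star
    by (simp add: Ball_def)
  have const: "z j = c" if "eventually (\<lambda>n. x n j = c) sequentially" for j c
    using tendsto_unique[OF _ lim tendsto_eventually[OF that]] by simp
  have 2: "z (i + 1 + k) = block L k" if "z i = star" "z (i + 1 + L) = star"
    "\<forall>k<L. z (i + 1 + k) \<noteq> star" "k < L" for i L k
    by (rule const, rule eventually_mono[OF ev_stars[of "i + 1 + L"]])
      (use that in \<open>auto intro!: block_spaceD(2)[OF x, of _ i L k, simplified]\<close>)
  have 3: "z (i + 1 + k) = 0" if "z i = star" "\<forall>l\<le>2*k. z (i + 1 + l) \<noteq> star" for i k
    by (rule const, rule eventually_mono[OF ev_stars[of "i + 1 + 2 * k"]])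
      (use that in \<open>auto intro!: block_spaceD(3)[OF x, of _ i k, simplified]\<close>)
  have 4: "z i < z j" if "i < j" and ns: "\<forall>l. i \<le> l \<longrightarrow> l \<le> j \<longrightarrow> z l \<noteq> star"
     and v: "0 < z i" "z i < 1" "0 < z j" "z j < 1" for i j
  proof -
    have ev_i: "eventually (\<lambda>n. x n i = z i) sequentially"
      and ev_j: "eventually (\<lambda>n. x n j = z j) sequentially"
      using v by (auto intro!: ev)
    have "eventually (\<lambda>n. z i < z j) sequentially"
      using ev_stars[of j] ev_i ev_j
    proof (eventually_elim)
      case (elim n)
      then show ?case
        using block_spaceD(4)[OF x, of i j n] that v by auto
    qed
    then show ?thesis by simp
  qed
  show ?thesis
    unfolding block_space_def using 1 2 3 4 by blast
qed

lemma tendsto_coordinate: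
  fixes x :: "nat \<Rightarrow> nat \<Rightarrow> real"
  assumes "x \<longlonglongrightarrow> z" shows "(\<lambda>n. x n j) \<longlonglongrightarrow> z j"
  using continuous_on_tendsto_compose[OF continuous_on_product_coordinates[of j] assms] by simp

lemma compact_block_space: "compact block_space"
proof -
  have "compactin (product_topology (\<lambda>_. euclidean) UNIV) (Pi\<^sub>E (UNIV :: nat set) (\<lambda>_. insert star letters))"
    using compact_letters by (simp add: compactin_PiE)
  then have "compact (Pi\<^sub>E (UNIV :: nat set) (\<lambda>_. insert star letters))"
    by (simp add: euclidean_product_topology)
  moreover have "block_space \<subseteq> Pi\<^sub>E UNIV (\<lambda>_. insert star letters)"
    using block_spaceD(1) by (auto simp: PiE_iff)
  moreover have "closed block_space"
    unfolding closed_sequential_limits using block_space_limit tendsto_coordinate by blast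
  ultimately show ?thesis
    by (metis compact_Int_closed inf.absorb2)
qed

section \<open>The metric and the preimages\<close>

text \<open>
  The factor by which the metric of the function space weights coordinate $0$.
\<close>

definition first_weight :: real where
  "first_weight = (1/2) ^ to_nat (0 :: nat)"

lemma first_weight_pos: "0 < first_weight"
  by (simp add: first_weight_def)

lemma dist_first_coordinate:
  fixes x y :: "nat \<Rightarrow> real"
  assumes "1 \<le> \<bar>x 0 - y 0\<bar>" shows "first_weight \<le> dist x y"
proof -
  have s: "summable (\<lambda>n. (1/2)^n * min (dist (x (from_nat n)) (y (from_nat n))) 1)"
    by (rule summable_comparison_test'[of "\<lambda>n. (1/2)^n"]) (auto simp: summable_geometric_iff)
  have "(\<Sum>n\<in>{to_nat (0::nat)}. (1/2)^n * min (dist (x (from_nat n)) (y (from_nat n))) 1) \<le> dist x y"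
    unfolding dist_fun_def by (rule sum_le_suminf[OF s]) auto
  then show ?thesis using assms by (simp add: first_weight_def dist_real_def min_def split: if_splits)
qed

lemma dist_initial_coordinates:
  assumes "0 < \<epsilon>"
  shows "\<exists>R \<eta>. 0 < \<eta> \<and> (\<forall>x y :: nat \<Rightarrow> real. (\<forall>j<R. \<bar>x j - y j\<bar> \<le> \<eta>) \<longrightarrow> dist x y \<le> \<epsilon>)"
proof -
  obtain N where N: "(1/2)^N < \<epsilon> / 2"
    using real_arch_pow_inv[of "\<epsilon> / 2" "1/2"] assms by auto
  define R where "R = Suc (Max ((from_nat :: nat \<Rightarrow> nat) ` {..N}))"
  have "dist x y \<le> \<epsilon>" if "\<forall>j<R. \<bar>x j - y j\<bar> \<le> \<epsilon> / 4" for x y :: "nat \<Rightarrow> real"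
  proof -
    have "from_nat n < R" if "n \<le> N" for n
      unfolding R_def using that by (auto simp: less_Suc_eq_le intro!: Max_ge)
    then have "Max {dist (x (from_nat n)) (y (from_nat n)) |n. n \<le> N} \<le> \<epsilon> / 4"
      using that by (intro Max.boundedI) (auto simp: dist_real_def)
    then show ?thesis
      using dist_fun_le_dist_first_terms[of x y N] N by simp
  qed
  then show ?thesis using assms by (intro exI[of _ R] exI[of _ "\<epsilon> / 4"]) auto
qed

lemma preimage_dist:
  assumes "z \<in> block_space"
  shows "diameter (seq_shift -` {z} \<inter> block_space) \<ge> first_weight"
proof -
  have "case_nat 0 z \<in> block_space" "case_nat 1 z \<in> block_space"
    using assms by (auto intro!: block_space_prepend)
  then have "dist (case_nat 0 z) (case_nat 1 z) \<le> diameter (seq_shift -` {z} \<inter> block_space)"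
    by (intro diameter_bounded_bound bounded_subset[OF compact_imp_bounded[OF compact_block_space]]) auto
  moreover have "first_weight \<le> dist (case_nat 0 z) (case_nat 1 z)"
    by (rule dist_first_coordinate) simp
  ultimately show ?thesis by simp
qed

text \<open>
  The first letter of the initial word that is strictly between $0$ and $1$ is the smallest one, so
  all sufficiently small letters can be put in front.
\<close>

lemma infinite_preimage:
  assumes z: "z \<in> block_space"
  shows "infinite (seq_shift -` {z} \<inter> block_space)"
proof -
  define P where "P j \<longleftrightarrow> (\<forall>l\<le>j. z l \<noteq> star) \<and> 0 < z j \<and> z j < 1" for j
  obtain b where b: "b > 0" "\<And>j. P j \<Longrightarrow> b \<le> z j"
  proof (cases "\<exists>j. P j")
    case True
    define j0 where "j0 = (LEAST j. P j)"
    have j0: "P j0" "\<And>j. P j \<Longrightarrow> j0 \<le> j"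
      using True by (auto simp: j0_def intro: LeastI Least_le)
    have "z j0 \<le> z j" if "P j" for j
      using j0(2)[OF that] block_spaceD(4)[OF z, of j0 j] that j0(1)
      by (cases "j0 = j") (auto simp: P_def)
    then show ?thesis using that[of "z j0"] j0(1) by (auto simp: P_def)
  qed (use that[of 1] in auto)
  obtain m0 :: nat where m0: "1 / b < real m0"
    using reals_Archimedean2 by blast
  have "(\<lambda>m. case_nat (1 / real m) z) ` {m0..} \<subseteq> seq_shift -` {z} \<inter> block_space"
  proof (rule image_subsetI)
    fix m assume "m \<in> {m0..}"
    then have "1 / b < real m" using m0 by simp
    then have "1 / real m < b" using b(1) by (cases "m = 0") (auto simp: field_simps)
    then have "case_nat (1 / real m) z \<in> block_space"
      using b(2) by (intro block_space_prepend z) (fastforce simp: P_def)+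
    then show "case_nat (1 / real m) z \<in> seq_shift -` {z} \<inter> block_space"
      by simp
  qed
  moreover have "inj_on (\<lambda>m. case_nat (1 / real m) z) {m0..}"
    by (rule inj_onI, drule fun_cong[of _ _ 0]) simp
  ultimately show ?thesis
    by (meson finite_imageD finite_subset infinite_Ici)
qed

section \<open>Topological entropy\<close>

text \<open>
  The two alternatives for $q$ treat a gap that ends at $q$ and a gap that is only known to reach
  beyond $2j$; in the second case both sides are $0$.
\<close>

lemma block_content:
  assumes z: "z \<in> block_space" and p: "z p = star" "p < j" "j < q"
    and ns: "\<And>l. p < l \<Longrightarrow> l < q \<Longrightarrow> z l \<noteq> star"
    and q: "z q = star \<or> 2 * j \<le> q"
  shows "z j = block (q - p - 1) (j - p - 1)"
proof (cases "2 * j \<le> q")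
  case True
  have "z (p + 1 + (j - p - 1)) = 0"
    using ns p True by (intro block_spaceD(3)[OF z]) auto
  moreover have "block (q - p - 1) (j - p - 1) = 0"
    using p True by (intro block_initial) auto
  ultimately show ?thesis using p by simp
next
  case False
  have "z (p + 1 + (j - p - 1)) = block (q - p - 1) (j - p - 1)"
    using ns p False q by (intro block_spaceD(2)[OF z]) auto
  then show ?thesis using p by simp
qed

lemma eq_after_star:
  assumes zz: "z \<in> block_space" "z' \<in> block_space"
    and stars: "\<And>l. l < q \<Longrightarrow> z l = star \<longleftrightarrow> z' l = star"
    and q: "z q = star \<or> 2 * j \<le> q" "z' q = star \<or> 2 * j \<le> q"
    and p0: "z p0 = star" "p0 \<le> j" and jq: "j < q"
  shows "z j = z' j"
proof -
  define p where "p = (GREATEST p. p \<le> j \<and> z p = star)"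
  have p: "p \<le> j" "z p = star"
    using GreatestI_nat[of "\<lambda>p. p \<le> j \<and> z p = star" p0 j] p0 by (auto simp: p_def)
  have p_max: "z l \<noteq> star" if "p < l" "l \<le> j" for l
    using Greatest_le_nat[of "\<lambda>p. p \<le> j \<and> z p = star" l j] that by (auto simp: p_def[symmetric])
  have p': "z' p = star" using stars[of p] p jq by auto
  show ?thesis
  proof (cases "p = j")
    case True
    then show ?thesis using p p' by simp
  next
    case False
    then have pj: "p < j" using p by simp
    define r where "r = (LEAST r. j < r \<and> (r = q \<or> z r = star))"
    have r: "j < r" "r = q \<or> z r = star" and r_le: "r \<le> q"
      using LeastI[of "\<lambda>r. j < r \<and> (r = q \<or> z r = star)" q]
        Least_le[of "\<lambda>r. j < r \<and> (r = q \<or> z r = star)" q] jq by (auto simp: r_def)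
    have r_min: "z l \<noteq> star" if "j < l" "l < r" for l
      using not_less_Least[of l "\<lambda>r. j < r \<and> (r = q \<or> z r = star)"] that by (auto simp: r_def)
    have ns: "z l \<noteq> star" "z' l \<noteq> star" if "p < l" "l < r" for l
      using that p_max[of l] r_min[of l] stars[of l] r_le by (auto simp: not_le[symmetric])
    have "z' r = star \<or> 2 * j \<le> r" "z r = star \<or> 2 * j \<le> r"
      using r q r_le stars[of r] by (cases "r = q"; auto)+
    then show ?thesis
      using block_content[OF zz(1) p(2) pj r(1)] block_content[OF zz(2) p' pj r(1)] ns by simp
  qed
qed

definition first_star :: "(nat \<Rightarrow> real) \<Rightarrow> nat \<Rightarrow> nat" where
  "first_star z N = (LEAST k. z k = star \<or> k = N)"

text \<open>
  The search stops at $2N$: a gap reaching from before $N$ up to $2N$ has zeros at all its positions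
  below $N$.
\<close>

definition next_star :: "(nat \<Rightarrow> real) \<Rightarrow> nat \<Rightarrow> nat" where
  "next_star z N = (LEAST q. N \<le> q \<and> (z q = star \<or> q = 2 * N))"

lemma first_star:
  "first_star z N \<le> N" "z (first_star z N) = star \<or> first_star z N = N"
  "j < first_star z N \<Longrightarrow> z j \<noteq> star"
  using LeastI[of "\<lambda>k. z k = star \<or> k = N" N] Least_le[of "\<lambda>k. z k = star \<or> k = N" N]
    not_less_Least[of j "\<lambda>k. z k = star \<or> k = N"]
  by (auto simp: first_star_def)

lemma next_star:
  "N \<le> next_star z N" "next_star z N \<le> 2 * N" "z (next_star z N) = star \<or> next_star z N = 2 * N"
  "N \<le> j \<Longrightarrow> j < next_star z N \<Longrightarrow> z j \<noteq> star"
  using LeastI[of "\<lambda>q. N \<le> q \<and> (z q = star \<or> q = 2 * N)" "2 * N"]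
    Least_le[of "\<lambda>q. N \<le> q \<and> (z q = star \<or> q = 2 * N)" "2 * N"]
    not_less_Least[of j "\<lambda>q. N \<le> q \<and> (z q = star \<or> q = 2 * N)"]
  by (auto simp: next_star_def)

definition position :: "(nat \<Rightarrow> real) \<Rightarrow> nat \<Rightarrow> nat \<Rightarrow> nat" where
  "position z N m = (LEAST j. j = N \<or> j < first_star z N \<and> z j = 1 / real m)"

lemma position_le: "position z N m \<le> N"
  unfolding position_def by (rule Least_le) simp

lemma position_eq:
  assumes z: "z \<in> block_space" and j: "j < first_star z N" "z j = 1 / real m" and m: "2 \<le> m"
  shows "position z N m = j"
  unfolding position_def
proof (rule Least_equality)
  fix i assume i: "i = N \<or> i < first_star z N \<and> z i = 1 / real m"
  show "j \<le> i"
  proof (rule ccontr)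
    assume "\<not> j \<le> i"
    then have "i < j" by simp
    moreover have "z i = 1 / real m"
      using i j \<open>i < j\<close> first_star(1)[of z N] by auto
    moreover have "z l \<noteq> star" if "l \<le> j" for l
      using first_star(3)[of l z N] j that by simp
    ultimately show False
      using block_spaceD(4)[OF z, of i j] j m by auto
  qed
qed (use j in simp)

lemma position_less:
  assumes "position z N m < N" shows "z (position z N m) = 1 / real m"
  using LeastI[of "\<lambda>j. j = N \<or> j < first_star z N \<and> z j = 1 / real m" N] assms
  by (auto simp: position_def)

text \<open>
  The entropy count. In front of the first star the second component records the entries $1$, from
  there on it records the stars. One bit per coordinate suffices because behind the first star the
  entries are determined by the stars. The remaining components take only polynomially many values.
\<close>

definition profile where
  "profile M N z = (first_star z N, {j. j < N \<and> (if j < first_star z N then z j = 1 else z j = star)},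
     restrict (position z N) {2..<M}, next_star z N)"

definition profiles :: "nat \<Rightarrow> nat \<Rightarrow> (nat \<times> nat set \<times> (nat \<Rightarrow> nat) \<times> nat) set" where
  "profiles M N = {..N} \<times> Pow {..<N} \<times> (PiE {2..<M} (\<lambda>_. {..N})) \<times> {..2 * N}"

lemma profile_in: "profile M N z \<in> profiles M N"
  using first_star(1)[of z N] next_star(2)[of z N] position_le[of z N]
  by (auto simp: profile_def profiles_def)

lemma finite_profiles: "finite (profiles M N)"
  unfolding profiles_def by (intro finite_cartesian_product finite_PiE) auto

lemma card_profiles: "card (profiles M N) = (N + 1) * 2 ^ N * (N + 1) ^ (M - 2) * (2 * N + 1)"
  unfolding profiles_def by (simp add: card_cartesian_product card_PiE card_Pow algebra_simps)

text \<open>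
  In front of the first star, an entry is $1$, or one of the finitely many letters exceeding $1/M$
  with its recorded position, or it lies in $[0, 1/M]$. From the first star on the two points agree.
\<close>

lemma profile_close:
  assumes zz: "z \<in> block_space" "z' \<in> block_space" and eq: "profile M N z = profile M N z'"
    and j: "j < N" and M: "0 < M"
  shows "\<bar>z j - z' j\<bar> \<le> 1 / real M"
proof -
  define k where "k = first_star z N"
  define q where "q = next_star z N"
  have k': "first_star z' N = k" and q': "next_star z' N = q"
    using eq by (auto simp: profile_def k_def q_def)
  have pos: "position z N m = position z' N m" if "2 \<le> m" "m < M" for m
  proof -
    have "restrict (position z N) {2..<M} = restrict (position z' N) {2..<M}"
      using eq by (simp add: profile_def)
    from fun_cong[OF this, of m] that show ?thesis by simp
  qed
  have sets: "{j. j < N \<and> (if j < k then z j = 1 else z j = star)} = {j. j < N \<and> (if j < k then z' j = 1 else z' j = star)}"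
    using eq k' by (simp add: profile_def k_def)
  have mem: "(if l < k then z l = 1 else z l = star) \<longleftrightarrow> (if l < k then z' l = 1 else z' l = star)" if "l < N" for l
    using eqset_imp_iff[OF sets, of l] that by simp
  show ?thesis
  proof (cases "j < k")
    case True
    have small: "y j \<le> 1 / real M" if y: "y \<in> block_space" "first_star y N = k" "y j \<noteq> 1"
        "\<And>m. 2 \<le> m \<Longrightarrow> m < M \<Longrightarrow> y j \<noteq> 1 / real m" for y
    proof -
      have "y j \<in> letters"
        using block_spaceD(1)[OF y(1)] first_star(3)[of j y N] True y(2) by simp
      then obtain m where m: "y j = 1 / real m" by (auto simp: letters_def)
      have "m = 0 \<or> M \<le> m" using y(3) y(4)[of m] m by (cases "m \<le> 1"; cases "M \<le> m") (auto simp: le_Suc_eq)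
      then show ?thesis using M by (auto simp: m intro: divide_left_mono)
    qed
    have nonneg: "0 \<le> y j" if y: "y \<in> block_space" for y
      using block_spaceD(1)[OF y, of j] lettersD(1)[of "y j"] by (cases "y j = star") auto
    consider "z j = 1" | "z' j = 1" | m where "2 \<le> m" "m < M" "z j = 1 / real m"
      | m where "2 \<le> m" "m < M" "z' j = 1 / real m"
      | "z j \<le> 1 / real M" "z' j \<le> 1 / real M"
      using small[OF zz(1)] small[OF zz(2)] k' k_def by metis
    then show ?thesis
    proof cases
      case (3 m)
      then have "position z N m = j" using position_eq[OF zz(1)] True by (simp add: k_def)
      then have "z' j = z j" using position_less[of z' N m] pos[of m] 3 j by simp
      then show ?thesis by simp
    next
      case (4 m)
      then have "position z' N m = j" using position_eq[OF zz(2)] True k' by simp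
      then have "z' j = z j" using position_less[of z N m] pos[of m] 4 j by simp
      then show ?thesis by simp
    qed (use mem[OF j] True nonneg[OF zz(1)] nonneg[OF zz(2)] in auto)
  next
    case False
    then have "z k = star" using first_star(2)[of z N] j by (auto simp: k_def)
    have "z l = star \<longleftrightarrow> z' l = star" if "l < q" for l
      using mem[of l] first_star(3)[of l z N] first_star(3)[of l z' N] next_star(4)[of N l z]
        next_star(4)[of N l z'] that q' k'
      by (cases "l < N"; cases "l < k") (auto simp: k_def q_def)
    moreover have "z q = star \<or> 2 * j \<le> q" "z' q = star \<or> 2 * j \<le> q" "j < q"
      using next_star(1)[of N z] next_star(3)[of z N] next_star(3)[of z' N] j q' by (auto simp: q_def)
    ultimately have "z j = z' j"
      using False \<open>z k = star\<close> by (intro eq_after_star[OF zz, of q j k]) auto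
    then show ?thesis by simp
  qed
qed

lemma card_separated_le:
  assumes "0 < \<epsilon>"
  shows "\<exists>R M. \<forall>n E. separated_set block_space seq_shift n \<epsilon> E \<longrightarrow> card E \<le> card (profiles M (n + R))"
proof -
  obtain R \<eta> where \<eta>: "0 < \<eta>"
    and R: "\<And>x y :: nat \<Rightarrow> real. (\<And>j. j < R \<Longrightarrow> \<bar>x j - y j\<bar> \<le> \<eta>) \<Longrightarrow> dist x y \<le> \<epsilon>"
    using dist_initial_coordinates[OF assms] by metis
  obtain M :: nat where M: "1 / real M < \<eta>" "0 < M"
    using \<eta> ex_inverse_of_nat_less[of \<eta>] by (auto simp: inverse_eq_divide)
  have "card E \<le> card (profiles M (n + R))" if E: "separated_set block_space seq_shift n \<epsilon> E" for n E
  proof (rule card_inj_on_le)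
    show "inj_on (profile M (n + R)) E"
    proof (rule inj_onI, rule ccontr)
      fix z z' assume zz: "z \<in> E" "z' \<in> E" "profile M (n + R) z = profile M (n + R) z'" "z \<noteq> z'"
      then obtain i where i: "i < n" "dist ((seq_shift ^^ i) z) ((seq_shift ^^ i) z') > \<epsilon>"
        using E unfolding separated_set_def by blast
      have X: "z \<in> block_space" "z' \<in> block_space"
        using E zz by (auto simp: separated_set_def)
      have "dist ((seq_shift ^^ i) z) ((seq_shift ^^ i) z') \<le> \<epsilon>"
      proof (rule R)
        fix j assume "j < R"
        then have "\<bar>z (i + j) - z' (i + j)\<bar> \<le> 1 / real M"
          using i by (intro profile_close[OF X zz(3)] M) auto
        then show "\<bar>(seq_shift ^^ i) z j - (seq_shift ^^ i) z' j\<bar> \<le> \<eta>"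
          using M by (simp add: funpow_shift)
      qed
      then show False using i by simp
    qed
  qed (use profile_in finite_profiles in auto)
  then show ?thesis by blast
qed

lemma sep_num_le:
  assumes "0 < \<epsilon>"
  shows "\<exists>R M. \<forall>n. sep_num block_space seq_shift n \<epsilon> \<le> card (profiles M (n + R))"
proof -
  obtain R M where RM: "\<And>n E. separated_set block_space seq_shift n \<epsilon> E \<Longrightarrow> card E \<le> card (profiles M (n + R))"
    using card_separated_le[OF assms] by blast
  have "separated_set block_space seq_shift n \<epsilon> {}" for n
    by (simp add: separated_set_def)
  then have "{card E |E. separated_set block_space seq_shift n \<epsilon> E} \<noteq> {}" for n
    by blast
  then have "sep_num block_space seq_shift n \<epsilon> \<le> card (profiles M (n + R))" for n
    unfolding sep_num_def using RM by (intro cSup_least) auto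
  then show ?thesis by blast
qed

lemma card_le_sep_num:
  assumes "0 < \<epsilon>" "separated_set block_space seq_shift n \<epsilon> E"
  shows "card E \<le> sep_num block_space seq_shift n \<epsilon>"
proof -
  obtain R M where RM: "\<And>n E. separated_set block_space seq_shift n \<epsilon> E \<Longrightarrow> card E \<le> card (profiles M (n + R))"
    using card_separated_le[OF assms(1)] by blast
  show ?thesis
    unfolding sep_num_def
  proof (rule cSup_upper)
    show "card E \<in> {card E |E. separated_set block_space seq_shift n \<epsilon> E}"
      using assms(2) by blast
    show "bdd_above {card E |E. separated_set block_space seq_shift n \<epsilon> E}"
      using RM[of n] by (intro bdd_aboveI[of _ "card (profiles M (n + R))"]) blast
  qed
qed

lemma indicator_in_block_space: "(\<lambda>j. if j \<in> S then 1 else 0) \<in> block_space"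
proof -
  have "(if j \<in> S then 1 else 0) \<noteq> star" "(if j \<in> S then 1 else 0 :: real) \<in> letters"
     "\<not> (0 < (if j \<in> S then 1 else 0 :: real) \<and> (if j \<in> S then 1 else 0 :: real) < 1)" for j
    by auto
  then show ?thesis unfolding block_space_def by blast
qed

lemma sep_num_ge: "2 ^ n \<le> sep_num block_space seq_shift n (first_weight / 2)"
proof -
  \<comment> \<open>Starfree sequences of zeros and ones: two different ones are at distance $1$ in some coordinate.\<close>
  define word where "word S = (\<lambda>j::nat. if j \<in> S then 1 else 0 :: real)" for S
  have inj: "inj_on word (Pow {..<n})"
  proof (rule inj_onI)
    fix S S' assume "word S = word S'"
    then have "word S j = word S' j" for j by simp
    then have "j \<in> S \<longleftrightarrow> j \<in> S'" for j
      by (metis word_def zero_neq_one)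
    then show "S = S'" by blast
  qed
  have "separated_set block_space seq_shift n (first_weight / 2) (word ` Pow {..<n})"
    unfolding separated_set_def
  proof (intro conjI ballI impI)
    show "word ` Pow {..<n} \<subseteq> block_space"
      using indicator_in_block_space by (auto simp: word_def)
    fix x y assume "x \<in> word ` Pow {..<n}" "y \<in> word ` Pow {..<n}" "x \<noteq> y"
    then obtain S S' where S: "x = word S" "y = word S'" "S \<subseteq> {..<n}" "S' \<subseteq> {..<n}" "S \<noteq> S'"
      by auto
    then obtain i where i: "i \<in> S \<longleftrightarrow> i \<notin> S'" by auto
    have "first_weight \<le> dist ((seq_shift ^^ i) x) ((seq_shift ^^ i) y)"
      using i by (intro dist_first_coordinate) (auto simp: funpow_shift S(1,2) word_def)
    then show "\<exists>i<n. first_weight / 2 < dist ((seq_shift ^^ i) x) ((seq_shift ^^ i) y)"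
      using i S first_weight_pos by (intro exI[of _ i]) auto
  qed simp
  then have "card (word ` Pow {..<n}) \<le> sep_num block_space seq_shift n (first_weight / 2)"
    by (intro card_le_sep_num) (simp_all add: first_weight_pos)
  then show ?thesis
    by (simp add: card_image[OF inj] card_Pow)
qed

lemma entropy_block_space: "top_entropy block_space seq_shift = ereal (ln 2)"
proof (rule antisym)
  define growth where "growth \<epsilon> = limsup (\<lambda>n. ereal (ln (real (sep_num block_space seq_shift n \<epsilon>)) / real n))" for \<epsilon>
  have "growth \<epsilon> \<le> ereal (ln 2)" if \<epsilon>: "0 < \<epsilon>" for \<epsilon>
  proof -
    obtain R M where RM: "\<And>n. sep_num block_space seq_shift n \<epsilon> \<le> card (profiles M (n + R))"
      using sep_num_le[OF \<epsilon>] by blast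
    define b where "b n = (real (M - 2 + 1) * ln (real n + real R + 1) + (real n + real R) * ln 2
      + ln (2 * (real n + real R) + 1)) / real n" for n :: nat
    have card: "ln (real (card (profiles M N))) =
        real (M - 2 + 1) * ln (real N + 1) + real N * ln 2 + ln (2 * real N + 1)" for N
      
    proof -
      have "ln (real (card (profiles M N))) =
          ln ((real N + 1) * 2 ^ N * (real N + 1) ^ (M - 2) * (2 * real N + 1))"
        by (simp only: card_profiles of_nat_mult of_nat_add of_nat_power of_nat_1 of_nat_numeral)
      also have "\<dots> = ln (real N + 1) + real N * ln 2 + real (M - 2) * ln (real N + 1) + ln (2 * real N + 1)"
        by (subst ln_mult_pos, simp, simp)+ (simp add: ln_realpow)
      finally show ?thesis by (simp add: algebra_simps)
    qed
    have pos: "1 \<le> card (profiles M N)" for N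
      by (simp add: card_profiles Suc_le_eq)
    have "ln (real (sep_num block_space seq_shift n \<epsilon>)) / real n \<le> b n" for n
    proof -
      have "ln (real (sep_num block_space seq_shift n \<epsilon>)) \<le> ln (real (card (profiles M (n + R))))"
        using RM[of n] pos[of "n + R"]
        by (cases "sep_num block_space seq_shift n \<epsilon> = 0") auto
      then show ?thesis
        unfolding b_def card of_nat_add by (rule divide_right_mono) simp
    qed
    then have "growth \<epsilon> \<le> limsup (\<lambda>n. ereal (b n))"
      unfolding growth_def by (intro Limsup_mono always_eventually) simp
    moreover have "b \<longlonglongrightarrow> ln 2"
      unfolding b_def by real_asymp
    then have "limsup (\<lambda>n. ereal (b n)) = ereal (ln 2)"
      by (intro lim_imp_Limsup) auto
    ultimately show ?thesis by simp
  qed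
  then show "top_entropy block_space seq_shift \<le> ereal (ln 2)"
    unfolding top_entropy_def growth_def by (intro SUP_least) auto
  have "ereal (ln 2) = limsup (\<lambda>n::nat. ereal (ln 2))"
    by (simp add: Limsup_const)
  also have "\<dots> \<le> growth (first_weight / 2)"
    unfolding growth_def
  proof (intro Limsup_mono eventually_mono[OF eventually_gt_at_top[of 0]])
    fix n :: nat assume n: "0 < n"
    have "(2::real) ^ n \<le> real (sep_num block_space seq_shift n (first_weight / 2))"
      using sep_num_ge[of n] by (metis of_nat_le_iff of_nat_numeral of_nat_power)
    then have "ln (2 ^ n) \<le> ln (real (sep_num block_space seq_shift n (first_weight / 2)))"
      by (subst ln_le_cancel_iff) (auto intro: less_le_trans[of 0 "2 ^ n"])
    then show "ereal (ln 2) \<le> ereal (ln (real (sep_num block_space seq_shift n (first_weight / 2))) / real n)"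
      using n by (simp add: ln_realpow field_simps)
  qed
  also have "\<dots> \<le> top_entropy block_space seq_shift"
    unfolding top_entropy_def growth_def by (rule SUP_upper) (simp add: first_weight_pos)
  finally show "ereal (ln 2) \<le> top_entropy block_space seq_shift" .
qed

section \<open>Filling the gaps of a coin sequence\<close>

text \<open>
  A coin sequence prescribes the stars. The parameter $i$ says how many nonstar positions lie between
  the preceding star and position $0$; it is all that has to be known of the past in order to fill
  the gaps.
\<close>

primrec age :: "nat \<Rightarrow> bool stream \<Rightarrow> nat \<Rightarrow> nat" where
  "age i x 0 = i"
| "age i x (Suc j) = (if x !! j then 0 else Suc (age i x j))"

definition fill :: "nat \<Rightarrow> bool stream \<Rightarrow> nat \<Rightarrow> real" where
  "fill i x j = (if x !! j then star
     else if \<exists>n. x !! (j + n) then block (age i x j + (LEAST n. x !! (j + n))) (age i x j) else 0)"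

lemma age_stl: "age i x (Suc j) = age (if shd x then 0 else Suc i) (stl x) j"
  by (induction j) auto

lemma shift_fill: "seq_shift (fill i x) = fill (if shd x then 0 else Suc i) (stl x)"
proof
  fix j
  have "x !! (Suc j + n) = stl x !! (j + n)" for n by simp
  then show "seq_shift (fill i x) j = fill (if shd x then 0 else Suc i) (stl x) j"
    unfolding seq_shift_def fill_def age_stl by (simp only: snth.simps)
qed

lemma age_gap:
  assumes "\<And>l. p \<le> l \<Longrightarrow> l < p + d \<Longrightarrow> \<not> x !! l"
  shows "age i x (p + d) = age i x p + d"
  using assms by (induction d) auto

lemma fill_star: "fill i x j = star \<longleftrightarrow> x !! j"
  using lettersD(3)[OF block_letters] by (auto simp: fill_def)

lemma fill_gap:
  assumes "\<And>l. p \<le> l \<Longrightarrow> l < q \<Longrightarrow> \<not> x !! l" "x !! q" "p \<le> j" "j < q"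
  shows "fill i x j = block (age i x p + (q - p)) (age i x p + (j - p))"
proof -
  have "(LEAST n. x !! (j + n)) = q - j"
  proof (rule Least_equality)
    fix n assume "x !! (j + n)"
    then have "\<not> j + n < q" using assms(1)[of "j + n"] assms(3) by auto
    then show "q - j \<le> n" by simp
  qed (use assms in simp)
  moreover have "age i x j = age i x p + (j - p)"
    using age_gap[of p "j - p" x i] assms by auto
  moreover have "\<exists>n. x !! (j + n)"
    using assms by (intro exI[of _ "q - j"]) simp
  ultimately show ?thesis
    using assms by (simp add: fill_def)
qed

lemma fill_no_star: "(\<And>l. j \<le> l \<Longrightarrow> \<not> x !! l) \<Longrightarrow> fill i x j = 0"
  by (simp add: fill_def)

lemma obtain_next_star:
  assumes "x !! l" "(j::nat) \<le> l"
  obtains q where "j \<le> q" "x !! q" "\<And>l. j \<le> l \<Longrightarrow> l < q \<Longrightarrow> \<not> x !! l"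
proof -
  let ?q = "LEAST q. j \<le> q \<and> x !! q"
  show thesis
    using LeastI[of "\<lambda>q. j \<le> q \<and> x !! q" l] assms not_less_Least[of _ "\<lambda>q. j \<le> q \<and> x !! q"]
    by (intro that[of ?q]) blast+
qed

lemma fill_in_block_space: "fill i x \<in> block_space"
proof -
  have 1: "fill i x j = star \<or> fill i x j \<in> letters" for j
    by (auto simp: fill_def block_letters)
  have 2: "fill i x (s + 1 + k) = block L k" if "fill i x s = star" "fill i x (s + 1 + L) = star"
    "\<forall>k<L. fill i x (s + 1 + k) \<noteq> star" "k < L" for s L k
  proof -
    have "\<not> x !! l" if "s + 1 \<le> l" "l < s + 1 + L" for l
      using \<open>\<forall>k<L. fill i x (s + 1 + k) \<noteq> star\<close>[rule_format, of "l - (s + 1)"] that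
      by (simp add: fill_star)
    then have "fill i x (s + 1 + k) =
        block (age i x (s + 1) + (s + 1 + L - (s + 1))) (age i x (s + 1) + (s + 1 + k - (s + 1)))"
      using that by (intro fill_gap) (auto simp: fill_star)
    then show ?thesis using that(1) by (simp add: fill_star)
  qed
  have 3: "fill i x (s + 1 + k) = 0" if s: "fill i x s = star" "\<forall>l\<le>2*k. fill i x (s + 1 + l) \<noteq> star" for s k
  proof -
    have ns: "\<not> x !! l" if "s + 1 \<le> l" "l \<le> s + 1 + 2 * k" for l
      using s(2)[rule_format, of "l - (s + 1)"] that by (simp add: fill_star)
    show ?thesis
    proof (cases "\<exists>l\<ge>s + 1. x !! l")
      case True
      then obtain q where q: "s + 1 \<le> q" "x !! q" "\<And>l. s + 1 \<le> l \<Longrightarrow> l < q \<Longrightarrow> \<not> x !! l"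
        using obtain_next_star by metis
      have "s + 1 + 2 * k < q" using ns[of q] q by (auto simp: not_le[symmetric])
      then have "fill i x (s + 1 + k) =
          block (age i x (s + 1) + (q - (s + 1))) (age i x (s + 1) + (s + 1 + k - (s + 1)))"
        using q by (intro fill_gap) auto
      also have "\<dots> = 0"
        using s(1) \<open>s + 1 + 2 * k < q\<close> by (intro block_initial) (auto simp: fill_star)
      finally show ?thesis .
    qed (auto intro!: fill_no_star)
  qed
  have 4: "fill i x s < fill i x j" if sj: "s < j" and ns: "\<forall>l. s \<le> l \<longrightarrow> l \<le> j \<longrightarrow> fill i x l \<noteq> star"
     and v: "0 < fill i x s" "fill i x s < 1" "0 < fill i x j" "fill i x j < 1" for s j
  proof -
    have "\<exists>l\<ge>s. x !! l" using fill_no_star[of s x i] v(1) by force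
    then obtain q where q: "s \<le> q" "x !! q" "\<And>l. s \<le> l \<Longrightarrow> l < q \<Longrightarrow> \<not> x !! l"
      using obtain_next_star by metis
    have "j < q" using ns q by (auto simp: fill_star not_le[symmetric])
    have "fill i x s = block (age i x s + (q - s)) (age i x s + (s - s))"
      "fill i x j = block (age i x s + (q - s)) (age i x s + (j - s))"
      using q \<open>j < q\<close> sj by (intro fill_gap; auto)+
    moreover have "block (age i x s + (q - s)) (age i x s + (s - s)) < block (age i x s + (q - s)) (age i x s + (j - s))"
      using v sj \<open>j < q\<close> unfolding calculation by (intro block_increasing) auto
    ultimately show ?thesis by simp
  qed
  show ?thesis
    unfolding block_space_def using 1 2 3 4 by blast
qed

section \<open>Fair coins\<close>

definition coins :: "bool stream measure" where
  "coins = stream_space (measure_pmf (bernoulli_pmf (1/2)))"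

lemma prob_space_coins: "prob_space coins"
  unfolding coins_def by (intro prob_space.prob_space_stream_space prob_space_measure_pmf)

interpretation coins: prob_space coins by (rule prob_space_coins)

lemma space_coins [simp]: "space coins = UNIV"
  by (simp add: coins_def space_stream_space)

lemma sets_coins [measurable_cong]: "sets coins = sets (stream_space (count_space UNIV))"
  unfolding coins_def by (intro sets_stream_space_cong) simp

lemma emeasure_coins_step:
  assumes [measurable]: "B \<in> sets coins"
  shows "emeasure coins B = emeasure coins {x. True ## x \<in> B} / 2 + emeasure coins {x. False ## x \<in> B} / 2"
proof -
  have "emeasure coins B = (\<integral>\<^sup>+t. emeasure coins {x. t ## x \<in> B} \<partial>bernoulli_pmf (1/2))"
    using prob_space.emeasure_stream_space[OF prob_space_measure_pmf, of B "bernoulli_pmf (1/2)"] assms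
    unfolding coins_def[symmetric] by simp
  also have "\<dots> = emeasure coins {x. True ## x \<in> B} / 2 + emeasure coins {x. False ## x \<in> B} / 2"
    by (subst nn_integral_bernoulli_pmf)
      (auto simp: divide_ennreal_def ennreal_divide_times inverse_ennreal[symmetric] simp flip: ennreal_numeral)
  finally show ?thesis .
qed

lemma AE_coins_frequently_True: "AE x in coins. \<forall>n. \<exists>m\<ge>n. x !! m"
proof -
  have "AE x in coins. \<exists>m\<ge>n. x !! m" for n
  proof (induction n)
    case 0
    define N where "N = {x. \<forall>m. \<not> x !! m}"
    have [measurable]: "N \<in> sets coins"
    proof -
      have "N = {x \<in> space coins. \<forall>m. \<not> x !! m}" by (simp add: N_def)
      also have "\<dots> \<in> sets coins" by measurable
      finally show ?thesis .
    qed
    have N_iff: "x \<in> N \<longleftrightarrow> \<not> shd x \<and> stl x \<in> N" for x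
      unfolding N_def mem_Collect_eq by (metis not0_implies_Suc snth.simps)
    have "{x. True ## x \<in> N} = {}" "{x. False ## x \<in> N} = N"
      using N_iff[of "_ ## _"] by auto
    then have "emeasure coins N = emeasure coins N / 2"
      using emeasure_coins_step[of N] by simp
    then have "measure coins N = measure coins N / 2"
      by (simp add: coins.emeasure_eq_measure divide_ennreal flip: ennreal_numeral)
    then have "emeasure coins N = 0"
      by (simp add: coins.emeasure_eq_measure)
    then show ?case
      by (intro AE_I[OF _ _ \<open>N \<in> sets coins\<close>]) (auto simp: N_def)
  next
    case (Suc n)
    have "Measurable.pred coins (\<lambda>x. \<exists>m\<ge>Suc n. x !! m)" by measurable
    moreover have "AE x in coins. \<exists>m\<ge>Suc n. (b ## x) !! m" for b
      using Suc by eventually_elim (metis Suc_le_mono snth.simps(2) stream.sel(2))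
    ultimately show ?case
      unfolding coins_def by (subst prob_space.AE_stream_space[OF prob_space_measure_pmf]) auto
  qed
  then show ?thesis by (simp add: AE_all_countable)
qed

lemma emeasure_coins_Int_sstart:
  assumes [measurable]: "B \<in> sets coins" and inv: "\<And>x. stl x \<in> B \<longleftrightarrow> x \<in> B"
  shows "emeasure coins (B \<inter> sstart UNIV xs) = emeasure coins B * emeasure coins (sstart UNIV xs)"
proof (induction xs)
  case Nil
  then show ?case using coins.emeasure_space_1 by simp
next
  case (Cons a xs)
  have [measurable]: "sstart UNIV xs \<in> sets coins" for xs :: "bool list"
    unfolding sets_coins by (rule sets_sstart)
  have B: "b ## x \<in> B \<longleftrightarrow> x \<in> B" for b x
    using inv[of "b ## x"] by simp
  have step: "emeasure coins C = emeasure coins D / 2"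
    if "C \<in> sets coins" "\<And>b. {x. b ## x \<in> C} = (if b = a then D else {})" for C D
    using emeasure_coins_step[OF that(1)] that(2)[of True] that(2)[of False] by (cases a) simp_all
  have "emeasure coins (B \<inter> sstart UNIV (a # xs)) = emeasure coins (B \<inter> sstart UNIV xs) / 2"
    by (rule step) (auto simp: B)
  moreover have "emeasure coins (sstart UNIV (a # xs)) = emeasure coins (sstart UNIV xs) / 2"
    by (rule step) auto
  ultimately show ?case
    by (simp add: Cons.IH ennreal_times_divide)
qed

lemma emeasure_coins_sstart_pos: "0 < emeasure coins (sstart UNIV xs)"
proof (induction xs)
  case Nil
  then show ?case using coins.emeasure_space_1 by simp
next
  case (Cons a xs)
  have [measurable]: "sstart UNIV xs \<in> sets coins" for xs :: "bool list"
    unfolding sets_coins by (rule sets_sstart)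
  have "{x. b ## x \<in> sstart UNIV (a # xs)} = (if b = a then sstart UNIV xs else {})" for b
    by auto
  then have "emeasure coins (sstart UNIV (a # xs)) = emeasure coins (sstart UNIV xs) / 2"
    by (subst emeasure_coins_step; cases a; simp)
  then show ?case using Cons by (simp add: ennreal_zero_less_divide)
qed

text \<open>
  An invariant event is independent of every event that prescribes an initial segment, hence of
  itself: conditioning on it does not change the coin measure.
\<close>

lemma coins_zero_one:
  assumes [measurable]: "B \<in> sets coins" and inv: "\<And>x. stl x \<in> B \<longleftrightarrow> x \<in> B"
  shows "emeasure coins B = 0 \<or> emeasure coins B = 1"
proof (cases "emeasure coins B = 0")
  case False
  have fin: "emeasure coins B \<noteq> \<infinity>" by simp
  let ?U = "uniform_measure coins B"
  have eq: "emeasure ?U A = emeasure coins (B \<inter> A) / emeasure coins B" if "A \<in> sets coins" for A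
    using that by simp
  have "?U = coins"
  proof (rule stream_space_eq_sstart[of UNIV])
    show "prob_space ?U" using False fin by (rule prob_space_uniform_measure)
    fix xs :: "bool list"
    have "sstart UNIV xs \<in> sets coins" unfolding sets_coins by (rule sets_sstart)
    then show "emeasure ?U (sstart UNIV xs) = emeasure coins (sstart UNIV xs)"
      using False fin 
      by (simp add: eq emeasure_coins_Int_sstart[OF assms] mult.commute[of "emeasure coins B"] ennreal_mult_divide_eq)
  qed (simp_all add: prob_space_coins sets_coins)
  then have "emeasure coins B = emeasure ?U B" by simp
  also have "\<dots> = emeasure coins B / emeasure coins B"
    by (simp add: eq[OF assms(1)])
  also have "\<dots> = 1"
    using False by (intro ennreal_divide_self) (auto simp: coins.emeasure_eq_measure)
  finally show ?thesis by simp
qed simp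

section \<open>The stationary measure\<close>

text \<open>
  A geometric variable is $0$ or the successor of a geometric variable, with probability $1/2$ each.
  This matches the evolution of the age of a gap under one coin flip.
\<close>

lemma nn_integral_geometric_step:
  "(\<integral>\<^sup>+i. f i \<partial>geometric_pmf (1/2)) = f 0 / 2 + (\<integral>\<^sup>+i. f (Suc i) \<partial>geometric_pmf (1/2)) / 2"
proof -
  have "(\<integral>\<^sup>+i. f i \<partial>geometric_pmf (1/2)) = (\<integral>\<^sup>+b. (\<integral>\<^sup>+i. f i \<partial>
      (if b then return_pmf 0 else map_pmf Suc (geometric_pmf (1/2)))) \<partial>bernoulli_pmf (1/2))"
    by (subst geometric_bind_pmf_unfold) (simp_all add: nn_integral_bind_pmf)
  also have "\<dots> = f 0 / 2 + (\<integral>\<^sup>+i. f (Suc i) \<partial>geometric_pmf (1/2)) / 2"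
    by (subst nn_integral_bernoulli_pmf)
      (auto simp: divide_ennreal_def inverse_ennreal[symmetric] simp flip: ennreal_numeral)
  finally show ?thesis .
qed

lemma measurable_fill_coord [measurable]: "(\<lambda>x. fill i x j) \<in> borel_measurable coins"
proof -
  have [measurable]: "(\<lambda>x. age i x j) \<in> measurable coins (count_space UNIV)" for j
    by (induction j) simp_all
  have [measurable]: "(\<lambda>x. LEAST n. x !! (j + n)) \<in> measurable coins (count_space UNIV)"
    by measurable
  have [measurable]: "(\<lambda>x. block (age i x j + (LEAST n. x !! (j + n))) (age i x j)) \<in> borel_measurable coins"
    by measurable
  show ?thesis unfolding fill_def by measurable
qed

text \<open>
  In a stationary two-sided coin sequence the number of nonstar positions since the last star is
  geometric and independent of the future.
\<close>

definition block_measure :: "(nat \<Rightarrow> real) measure" where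
  "block_measure = distr (measure_pmf (geometric_pmf (1/2)) \<Otimes>\<^sub>M coins) (restrict_space borel block_space) (\<lambda>(i, x). fill i x)"

lemma sets_block_measure: "sets block_measure = sets (restrict_space borel block_space)"
  by (simp add: block_measure_def)

lemma space_block_measure: "space block_measure = block_space"
  by (simp add: block_measure_def space_restrict_space)

lemma measurable_fill:
  "(\<lambda>(i, x). fill i x) \<in> measurable (measure_pmf (geometric_pmf (1/2)) \<Otimes>\<^sub>M coins) (restrict_space borel block_space)"
proof (rule measurable_restrict_space2)
  show "(\<lambda>(i, x). fill i x) \<in> borel_measurable (measure_pmf (geometric_pmf (1/2)) \<Otimes>\<^sub>M coins)"
  proof (rule measurable_coordinatewise_then_product)
    fix j
    have "(\<lambda>p. fill (fst p) (snd p) j) \<in> borel_measurable (count_space UNIV \<Otimes>\<^sub>M coins)"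
      by (rule measurable_pair_measure_countable1) auto
    then show "(\<lambda>p. (case p of (i, x) \<Rightarrow> fill i x) j) \<in> borel_measurable (measure_pmf (geometric_pmf (1/2)) \<Otimes>\<^sub>M coins)"
      by (simp add: case_prod_beta cong: measurable_cong_sets sets_pair_measure_cong)
  qed
qed (auto simp: fill_in_block_space)

lemma sets_fill [measurable]:
  assumes "A \<in> sets block_measure" shows "{x. fill i x \<in> A} \<in> sets coins"
proof -
  have "fill i \<in> measurable coins (restrict_space borel block_space)"
    using fill_in_block_space
    by (intro measurable_restrict_space2 measurable_coordinatewise_then_product measurable_fill_coord) auto
  from measurable_sets[OF this, of A] show ?thesis
    using assms by (simp add: sets_block_measure vimage_def)
qed

lemma emeasure_block_measure:
  assumes A: "A \<in> sets block_measure"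
  shows "emeasure block_measure A = (\<integral>\<^sup>+i. emeasure coins {x. fill i x \<in> A} \<partial>geometric_pmf (1/2))"
proof -
  let ?P = "measure_pmf (geometric_pmf (1/2)) \<Otimes>\<^sub>M coins"
  have "emeasure block_measure A = emeasure ?P ((\<lambda>(i, x). fill i x) -` A \<inter> space ?P)"
    unfolding block_measure_def using A by (intro emeasure_distr measurable_fill) (simp add: sets_block_measure)
  also have "\<dots> = (\<integral>\<^sup>+i. emeasure coins (Pair i -` ((\<lambda>(i, x). fill i x) -` A \<inter> space ?P)) \<partial>geometric_pmf (1/2))"
    using A by (intro coins.emeasure_pair_measure_alt measurable_sets[OF measurable_fill]) (simp add: sets_block_measure)
  finally show ?thesis
    by (simp add: space_pair_measure vimage_def)
qed

lemma prob_space_block_measure: "prob_space block_measure"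
proof
  show "emeasure block_measure (space block_measure) = 1"
    using fill_in_block_space coins.emeasure_space_1 measure_pmf.emeasure_space_1
    by (subst emeasure_block_measure[OF sets.top]) (simp_all add: space_block_measure)
qed

text \<open>
  The shift turns the pair $(i, x)$ into $(0, x')$ or $(i + 1, x')$, according to the first coin of
  $x$, and the geometric law of $i$ is stationary for this transition.
\<close>

lemma invariant_block_measure: "invariant_measure seq_shift block_measure"
  unfolding invariant_measure_def
proof (intro conjI ballI)
  have "seq_shift \<in> measurable (restrict_space borel block_space) (restrict_space borel block_space)"
    using continuous_shift block_space_shift
    by (intro measurable_restrict_space2 measurable_restrict_space1 borel_measurable_continuous_onI)
       (auto simp: space_restrict_space)
  then show T: "seq_shift \<in> measurable block_measure block_measure"
    by (simp add: sets_block_measure cong: measurable_cong_sets)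
  fix A assume A: "A \<in> sets block_measure"
  let ?g = "\<lambda>i. emeasure coins {x. fill i x \<in> A}"
  have TA: "seq_shift -` A \<inter> space block_measure \<in> sets block_measure"
    using measurable_sets[OF T A] .
  have step: "emeasure coins {x. fill i x \<in> seq_shift -` A \<inter> space block_measure} = ?g 0 / 2 + ?g (Suc i) / 2" for i
    using emeasure_coins_step[OF sets_fill[OF TA, of i]]
    by (simp add: space_block_measure fill_in_block_space shift_fill)
  have "emeasure block_measure (seq_shift -` A \<inter> space block_measure)
      = (\<integral>\<^sup>+i. ?g 0 / 2 + ?g (Suc i) / 2 \<partial>geometric_pmf (1/2))"
    by (simp only: emeasure_block_measure[OF TA] step)
  also have "\<dots> = ?g 0 / 2 + (\<integral>\<^sup>+i. ?g (Suc i) \<partial>geometric_pmf (1/2)) / 2"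
    by (simp add: nn_integral_add nn_integral_divide)
  also have "\<dots> = emeasure block_measure A"
    by (simp only: emeasure_block_measure[OF A] nn_integral_geometric_step[of ?g])
  finally show "emeasure block_measure (seq_shift -` A \<inter> space block_measure) = emeasure block_measure A" .
qed

text \<open>
  Once a star has passed, the age at time $0$ is forgotten. So membership in an invariant set does
  not depend on the age, and it is an invariant event of the coin sequence alone.
\<close>

lemma ergodic_block_measure: "ergodic_measure seq_shift block_measure"
  unfolding ergodic_measure_def
proof (intro conjI ballI impI invariant_block_measure)
  interpret prob_space block_measure by (rule prob_space_block_measure)
  fix A assume A: "A \<in> sets block_measure" and inv: "seq_shift -` A \<inter> space block_measure = A"
  have A_iff: "fill i x \<in> A \<longleftrightarrow> fill (if shd x then 0 else Suc i) (stl x) \<in> A" for i x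
  proof -
    have "fill i x \<in> A \<longleftrightarrow> fill i x \<in> seq_shift -` A \<inter> space block_measure" using inv by simp
    then show ?thesis by (simp add: space_block_measure fill_in_block_space shift_fill)
  qed
  have indep: "fill i x \<in> A \<longleftrightarrow> fill i' x \<in> A" if "x !! m" for i i' x m
    using that
  proof (induction m arbitrary: i i' x)
    case 0
    then show ?case using A_iff[of i x] A_iff[of i' x] by simp
  next
    case (Suc m)
    then show ?case
      using A_iff[of i x] A_iff[of i' x] Suc.IH[of "stl x" "if shd x then 0 else Suc i" "if shd x then 0 else Suc i'"]
      by simp
  qed
  define B where "B = {x. (\<forall>n. \<exists>m\<ge>n. x !! m) \<and> fill 0 x \<in> A}"
  have [measurable]: "{x. fill i x \<in> A} \<in> sets coins" for i using A by (rule sets_fill)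
  have [measurable]: "B \<in> sets coins"
  proof -
    have "B = {x \<in> space coins. \<forall>n. \<exists>m\<ge>n. x !! m} \<inter> {x. fill 0 x \<in> A}" by (auto simp: B_def)
    also have "\<dots> \<in> sets coins" by measurable
    finally show ?thesis .
  qed
  have "stl x \<in> B \<longleftrightarrow> x \<in> B" for x
  proof -
    have "(\<forall>n. \<exists>m\<ge>n. stl x !! m) \<longleftrightarrow> (\<forall>n. \<exists>m\<ge>n. x !! m)"
      by (metis Suc_le_D Suc_le_mono le_SucI snth.simps(2))
    moreover have "fill 0 (stl x) \<in> A \<longleftrightarrow> fill 0 x \<in> A" if "stl x !! m" for m
      using A_iff[of 0 x] indep[OF that] by metis
    ultimately show ?thesis by (auto simp: B_def)
  qed
  then have zero_one: "emeasure coins B = 0 \<or> emeasure coins B = 1"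
    by (intro coins_zero_one) auto
  have "emeasure coins {x. fill i x \<in> A} = emeasure coins B" for i
  proof (rule emeasure_eq_AE)
    show "AE x in coins. x \<in> {x. fill i x \<in> A} \<longleftrightarrow> x \<in> B"
      using AE_coins_frequently_True 
      by eventually_elim (use indep in \<open>unfold B_def, blast\<close>)
  qed auto
  then have "emeasure block_measure A = emeasure coins B"
    using measure_pmf.emeasure_space_1 by (simp add: emeasure_block_measure[OF A])
  then show "measure block_measure A = 0 \<or> measure block_measure A = 1"
    using zero_one by (auto simp: measure_def)
qed


text \<open>
  The initial word of the point becomes the end of a completed gap by choosing the age; behind the
  first star it is enough to flip the right coins up to the next star at or after $N$, or up to $2N$
  if there is none before.
\<close>

lemma fill_approximates:
  assumes z: "z \<in> block_space"
  shows "\<exists>i xs. \<forall>x\<in>sstart UNIV xs. \<forall>j<N. fill i x j = z j"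
proof -
  define k where "k = first_star z N"
  define q where "q = next_star z N"
  \<comment> \<open>Without a star before $N$, the visible word is closed by an artificial star at $N$.\<close>
  define xs where "xs = (if k < N then map (\<lambda>j. z j = star) [0..<Suc q] else replicate N False @ [True])"
  have ns: "z j \<noteq> star" if "j < k" for j
    using first_star(3) that unfolding k_def by blast
  have kN: "k \<le> N" "z k = star \<or> k = N" and Nq: "N \<le> q" "z q = star \<or> q = 2 * N"
    using first_star(1,2)[of z N] next_star(1)[of N z] next_star(3)[of z N] by (auto simp: k_def q_def)
  have "word_ok z k"
    unfolding word_ok_def using block_spaceD(1,4)[OF z] ns by fastforce
  then obtain i where i: "\<And>j. j < k \<Longrightarrow> block (i + k) (i + j) = z j"
    using block_suffix by blast
  have "fill i x j = z j" if x: "x \<in> sstart UNIV xs" and j: "j < N" for x j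
  proof -
    have x_xs: "x !! l = xs ! l" if "l < length xs" for l
      using x that by (subst (asm) sstart_eq) auto
    have len: "k < length xs" using kN Nq by (auto simp: xs_def)
    have first: "x !! k" "\<And>l. l < k \<Longrightarrow> \<not> x !! l"
      using x_xs len kN ns by (auto simp: xs_def nth_append simp del: upt_Suc split: if_splits)
    show ?thesis
    proof (cases "j < k")
      case True
      then have "fill i x j = block (age i x 0 + (k - 0)) (age i x 0 + (j - 0))"
        using first by (intro fill_gap) auto
      then show ?thesis using i[OF True] by simp
    next
      case False
      then have kj: "k < N" "k \<le> j" using j by auto
      have stars: "fill i x l = star \<longleftrightarrow> z l = star" if "l \<le> q" for l
        using x_xs[of l] that kj by (simp add: fill_star xs_def del: upt_Suc)
      show ?thesis
        using stars[of q] kj kN Nq j stars[of k]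
        by (intro eq_after_star[OF fill_in_block_space[of i x] z, of q j k] stars) auto
    qed
  qed
  then show ?thesis by blast
qed

lemma support_block_measure: "measure_support block_measure = block_space"
proof -
  have "0 < emeasure block_measure (U \<inter> block_space)" if z: "z \<in> block_space" and U: "open U" "z \<in> U" for z U
  proof -
    obtain \<epsilon> where \<epsilon>: "0 < \<epsilon>" "ball z \<epsilon> \<subseteq> U"
      using U openE by blast
    obtain R \<eta> where R: "0 < \<eta>" "\<And>x y :: nat \<Rightarrow> real. (\<forall>j<R. \<bar>x j - y j\<bar> \<le> \<eta>) \<Longrightarrow> dist x y \<le> \<epsilon> / 2"
      using dist_initial_coordinates[of "\<epsilon> / 2"] \<epsilon>(1) by auto
    obtain i xs where xs: "\<And>x j. x \<in> sstart UNIV xs \<Longrightarrow> j < R \<Longrightarrow> fill i x j = z j"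
      using fill_approximates[OF z, of R] by blast
    have "fill i x \<in> U" if "x \<in> sstart UNIV xs" for x
    proof -
      have "dist z (fill i x) \<le> \<epsilon> / 2"
        using xs[OF that] R by (intro R(2)) simp
      then show ?thesis using \<epsilon> by auto
    qed
    then have sub: "sstart UNIV xs \<subseteq> {x. fill i x \<in> U \<inter> block_space}"
      using fill_in_block_space by auto
    have A: "U \<inter> block_space \<in> sets block_measure"
      using U by (auto simp: sets_block_measure sets_restrict_space)
    let ?g = "\<lambda>i. emeasure coins {x. fill i x \<in> U \<inter> block_space}"
    have "0 < ?g i"
      using emeasure_mono[OF sub sets_fill[OF A]] emeasure_coins_sstart_pos less_le_trans by blast
    moreover have "0 < ennreal (pmf (geometric_pmf (1/2)) i)"
      by simp
    ultimately have "0 < ?g i * ennreal (pmf (geometric_pmf (1/2)) i)"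
      by (simp add: ennreal_zero_less_mult_iff)
    also have "\<dots> = (\<integral>\<^sup>+l. ?g l * indicator {i} l \<partial>geometric_pmf (1/2))"
      by (simp add: emeasure_pmf_single)
    also have "\<dots> \<le> (\<integral>\<^sup>+l. ?g l \<partial>geometric_pmf (1/2))"
      by (intro nn_integral_mono) (auto split: split_indicator)
    finally show ?thesis by (simp add: emeasure_block_measure[OF A])
  qed
  then show ?thesis
    unfolding measure_support_def space_block_measure by blast
qed

theorem mainTheorem6:
  shows "\<exists>(X :: (nat \<Rightarrow> real) set) T.
    X \<noteq> {} \<and> tds X T \<and> infinite_to_one X T \<and> no_small_preimages X T \<and>
    (\<exists>M. borel_probability_on X M \<and> ergodic_measure T M \<and> measure_support M = X) \<and>
    top_entropy X T = ereal (ln 2)"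
proof (intro exI conjI)
  show "block_space \<noteq> {}" using fill_in_block_space by blast
  show "tds block_space seq_shift"
    unfolding tds_def using compact_block_space continuous_shift shift_onto by blast
  show "infinite_to_one block_space seq_shift"
    unfolding infinite_to_one_def using infinite_preimage by blast
  show "no_small_preimages block_space seq_shift"
    unfolding no_small_preimages_def
    using preimage_dist first_weight_pos by (intro exI[of _ "first_weight / 2"]) force
  show "borel_probability_on block_space block_measure"
    unfolding borel_probability_on_def using prob_space_block_measure sets_block_measure by blast
  show "ergodic_measure seq_shift block_measure" by (rule ergodic_block_measure)
  show "measure_support block_measure = block_space" by (rule support_block_measure)
  show "top_entropy block_space seq_shift = ereal (ln 2)" by (rule entropy_block_space)
qed

end
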